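(* Let $\mu_0=\sum_{i=1}^Nc_0^i\delta_{w_0^i}$ with $N\le n$, $c_0^i\in\mathbb{R}$ and $w_0^i\in R_{\pi^i}\cap\mathbb{S}^{d-1}$, where $\pi^i=(\pi^i_1,\dots,\pi^i_n)\in\{0,1\}^n$, $i=1,\dots,N$. Let $\Pi=(\pi^i_j)_{1\le i\le N,\,1\le j\le n}\in\{0,1\}^{N\times n}$. Suppose that: (i) some $N\times N$ submatrix $\Pi_N$ of $\Pi$ (obtained by selecting $N$ columns) has full rank; (ii) for this submatrix, $\operatorname{perm}(\Pi_N)=|\det(\Pi_N)|$. Then the vectors $K\delta_{w_0^1},\dots,K\delta_{w_0^N}\in\mathbb{R}^n$ are linearly independent.
   Context: Setting. $d,n$ are positive integers, $x^1,\dots,x^n\in\mathbb{R}^d\setminus\{0\}$ are given data points, and $\sigma(z)=\max\{0,z\}$ is the ReLU function. $K:M(\mathbb{S}^{d-1})\to\mathbb{R}^n$ is $(K\mu)_j=\int_{\mathbb{S}^{d-1}}\sigma(\langle w,x^j\rangle)\,d\mu(w)$, so $K\delta_w=(\sigma(\langle w,x^1\rangle),\dots,\sigma(\langle w,x^n\rangle))$. For $\pi\in\{0,1\}^n$ the dual region $R_\pi$ is the open set of all $w\in\mathbb{R}^d$ such that, for every $j=1,\dots,n$, $\langle w,x^j\rangle>0$ if $\pi_j=1$ and $\langle w,x^j\rangle<0$ if $\pi_j=0$. The permanent of $M=(m_{ij})\in\mathbb{R}^{N\times N}$ is $\operatorname{perm}(M)=\sum_{p}\prod_{i=1}^Nm_{i,p(i)}$,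 the sum running over all permutations $p$ of $\{1,\dots,N\}$. *)

theory Defs
  imports "HOL-Probability.Probability"
begin

definition relu :: "real \<Rightarrow> real" where
  "relu z = max 0 z"

definition sphere_borel :: "'a::euclidean_space measure" where
  "sphere_borel = restrict_space borel (sphere 0 1)"

lemma space_sphere_borel: "space sphere_borel = (sphere 0 1 :: 'a::euclidean_space set)"
  by (simp add: sphere_borel_def space_restrict_space)

text \<open>The space \<open>M(S)\<close> of finite signed measures on the unit sphere \<open>S\<close> of \<open>'a\<close>.  Elements are
  countably additive real-valued functions on the Borel subsets of \<open>S\<close>, extended by \<open>0\<close> to the
  remaining sets so that equality is equality on Borel sets.  Since \<open>S\<close> is a compact metric space,
  every such measure is automatically Radon.\<close>

typedef (overloaded) 'a sphere_measure =
  "{\<nu> :: 'a::euclidean_space set \<Rightarrow> real.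
     (\<forall>A. A \<notin> sets sphere_borel \<longrightarrow> \<nu> A = 0) \<and>
     (\<forall>A. range A \<subseteq> sets sphere_borel \<longrightarrow> disjoint_family A \<longrightarrow>
        (\<lambda>i::nat. \<nu> (A i)) sums \<nu> (\<Union>i. A i))}"
  morphisms sm_val Abs_sphere_measure
  by (rule exI[of _ "\<lambda>_. 0"]) simp

setup_lifting type_definition_sphere_measure

instantiation sphere_measure :: (euclidean_space) real_vector
begin

lift_definition zero_sphere_measure :: "'a sphere_measure" is "\<lambda>_. 0"
  by simp

lift_definition plus_sphere_measure :: "'a sphere_measure \<Rightarrow> 'a sphere_measure \<Rightarrow> 'a sphere_measure"
  is "\<lambda>\<mu> \<nu> A. \<mu> A + \<nu> A"
  by (auto intro!: sums_add)

lift_definition uminus_sphere_measure :: "'a sphere_measure \<Rightarrow> 'a sphere_measure"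
  is "\<lambda>\<mu> A. - \<mu> A"
  by (auto intro!: sums_minus)

lift_definition minus_sphere_measure :: "'a sphere_measure \<Rightarrow> 'a sphere_measure \<Rightarrow> 'a sphere_measure"
  is "\<lambda>\<mu> \<nu> A. \<mu> A - \<nu> A"
  by (auto intro!: sums_diff)

lift_definition scaleR_sphere_measure :: "real \<Rightarrow> 'a sphere_measure \<Rightarrow> 'a sphere_measure"
  is "\<lambda>c \<mu> A. c * \<mu> A"
  by (auto intro!: sums_mult)

instance
  by standard (transfer; auto simp: algebra_simps)+

end

lift_definition dirac :: "'a::euclidean_space \<Rightarrow> 'a sphere_measure"
  is "\<lambda>w A. if A \<in> sets sphere_borel then indicator A w else 0"
proof (intro CollectI conjI allI impI)
  fix w :: 'a and A :: "nat \<Rightarrow> 'a set"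
  assume A: "range A \<subseteq> sets sphere_borel" "disjoint_family A"
  have "(\<lambda>i. indicator (A i) w :: real) sums indicator (\<Union>i. A i) w"
    using A(2) by (intro indicator_sums) (auto simp: disjoint_family_on_def)
  moreover have "(\<Union>i. A i) \<in> sets sphere_borel" "\<And>i. A i \<in> sets sphere_borel"
    using A(1) by auto
  ultimately show "(\<lambda>i. if A i \<in> sets sphere_borel then indicator (A i) w else (0::real)) sums
      (if (\<Union>i. A i) \<in> sets sphere_borel then indicator (\<Union>i. A i) w else 0)"
    by simp
qed simp

text \<open>Positive part of the Jordan decomposition,
  \<open>\<mu>\<^sup>+(A) = sup {\<mu>(B) | B \<subseteq> A Borel}\<close>; the negative part is the positive part of \<open>-\<mu>\<close>.
  Using \<^const>\<open>ennreal\<close> is harmless as \<open>B = {}\<close> contributes \<open>0\<close>.\<close>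

definition pos_part :: "'a::euclidean_space sphere_measure \<Rightarrow> 'a measure" where
  "pos_part \<mu> = measure_of (sphere 0 1) (sets sphere_borel)
     (\<lambda>A. SUP B\<in>{B \<in> sets sphere_borel. B \<subseteq> A}. ennreal (sm_val \<mu> B))"

definition sm_integral :: "'a::euclidean_space sphere_measure \<Rightarrow> ('a \<Rightarrow> real) \<Rightarrow> real" where
  "sm_integral \<mu> f = integral\<^sup>L (pos_part \<mu>) f - integral\<^sup>L (pos_part (- \<mu>)) f"

definition K :: "('n::finite \<Rightarrow> 'a::euclidean_space) \<Rightarrow> 'a sphere_measure \<Rightarrow> real ^ 'n" where
  "K x \<mu> = (\<chi> j. sm_integral \<mu> (\<lambda>w. relu (w \<bullet> x j)))"

definition dual_region :: "('n::finite \<Rightarrow> 'a::euclidean_space) \<Rightarrow> real ^ 'n \<Rightarrow> 'a set" where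
  "dual_region x p = {w. \<forall>j. (p $ j = 1 \<longrightarrow> w \<bullet> x j > 0) \<and> (p $ j = 0 \<longrightarrow> w \<bullet> x j < 0)}"

definition permanent :: "'a::comm_ring_1 ^ 'n ^ 'n \<Rightarrow> 'a" where
  "permanent M = (\<Sum>p | p permutes UNIV. \<Prod>i\<in>UNIV. M $ i $ p i)"

lemma pos_part_dirac:
  assumes w: "w \<in> sphere 0 1"
  shows "pos_part (dirac w) = return sphere_borel w"
proof -
  have "(SUP B\<in>{B \<in> sets sphere_borel. B \<subseteq> A}. ennreal (sm_val (dirac w) B)) =
      emeasure (return sphere_borel w) A"
    if A: "A \<in> sets sphere_borel" for A
  proof (rule SUP_eqI)
    fix y :: ennreal
    assume "\<And>B. B \<in> {B \<in> sets sphere_borel. B \<subseteq> A} \<Longrightarrow> ennreal (sm_val (dirac w) B) \<le> y"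
    from this[of A] show "emeasure (return sphere_borel w) A \<le> y"
      using A by (auto simp: dirac.rep_eq indicator_def)
  qed (use A in \<open>auto simp: dirac.rep_eq indicator_def\<close>)
  then have "pos_part (dirac w) =
      measure_of (sphere 0 1) (sets sphere_borel) (emeasure (return sphere_borel w))"
    unfolding pos_part_def
    by (intro measure_of_eq) (auto simp: space_sphere_borel[symmetric] sets.space_closed sets.sigma_sets_eq)
  also have "\<dots> = return sphere_borel w"
    using measure_of_of_measure[of "return sphere_borel w"] by (simp add: space_sphere_borel)
  finally show ?thesis .
qed

lemma pos_part_uminus_dirac: "pos_part (- dirac w) = null_measure sphere_borel"
proof -
  have "(SUP B\<in>{B \<in> sets sphere_borel. B \<subseteq> A}. ennreal (sm_val (- dirac w) B)) = 0"
    if A: "A \<in> sets sphere_borel" for A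
    using A by (intro SUP_eqI)
      (auto simp: dirac.rep_eq uminus_sphere_measure.rep_eq indicator_def ennreal_neg split: if_splits)
  then have "pos_part (- dirac w) =
      measure_of (sphere 0 1) (sets sphere_borel) (emeasure (null_measure sphere_borel))"
    unfolding pos_part_def
    by (intro measure_of_eq) (auto simp: space_sphere_borel[symmetric] sets.space_closed sets.sigma_sets_eq)
  also have "\<dots> = null_measure sphere_borel"
    using measure_of_of_measure[of "null_measure sphere_borel"] by (simp add: space_sphere_borel)
  finally show ?thesis .
qed

lemma K_dirac:
  assumes "w \<in> sphere 0 1"
  shows "K x (dirac w) = (\<chi> j. relu (w \<bullet> x j))"
proof -
  have m: "(\<lambda>w. relu (w \<bullet> x j)) \<in> borel_measurable sphere_borel" for j
    unfolding sphere_borel_def relu_def by (intro measurable_restrict_space1) measurable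
  show ?thesis
    using assms unfolding K_def sm_integral_def pos_part_dirac[OF assms] pos_part_uminus_dirac
    by (simp add: integral_return[OF _ m] space_sphere_borel)
qed

end

theory Submission
  imports Defs
begin

text \<open>Nonnegativity makes every term of the permanent dominate the corresponding signed term of the
  determinant, so the equality \<open>permanent A = \<bar>det A\<bar>\<close> forces all permutations contributing
  to the expansion to have the same sign. Which permutations contribute depends only on the zero
  pattern, so no cancellation can occur in the determinant of any other nonnegative matrix with that
  pattern, in particular in that of the matrix of ReLU values, whose zero pattern is that of the
  activation matrix.\<close>

lemma det_nonzero_same_pattern:
  fixes A B :: "real ^ 'n ^ 'n"
  assumes A: "\<And>i j. 0 \<le> A $ i $ j" and B: "\<And>i j. 0 \<le> B $ i $ j"
    and pattern: "\<And>i j. B $ i $ j = 0 \<longleftrightarrow> A $ i $ j = 0"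
    and perm: "permanent A = \<bar>det A\<bar>" and det: "det A \<noteq> 0"
  shows "det B \<noteq> 0"
proof -
  \<comment> \<open>The sign that all contributing permutations will turn out to share.\<close>
  define e :: real where "e = sgn (det A)"
  define S where "S = {p :: 'n \<Rightarrow> 'n. p permutes UNIV}"
  define a where "a p = (\<Prod>i\<in>UNIV. A $ i $ p i)" for p
  define b where "b p = (\<Prod>i\<in>UNIV. B $ i $ p i)" for p
  have fin: "finite S"
    unfolding S_def by (simp add: finite_permutations)
  have a_nonneg: "0 \<le> a p" and b_nonneg: "0 \<le> b p" and ab: "b p = 0 \<longleftrightarrow> a p = 0" for p
    unfolding a_def b_def using A B pattern by (auto intro: prod_nonneg)
  have e: "\<bar>e\<bar> = 1" "e * det A = \<bar>det A\<bar>"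
    using det by (auto simp: e_def sgn_if)
  have det_A: "det A = (\<Sum>p\<in>S. of_int (sign p) * a p)"
    and det_B: "det B = (\<Sum>p\<in>S. of_int (sign p) * b p)"
    by (simp_all add: det_def S_def a_def b_def)
  \<comment> \<open>Since \<open>e * of_int (sign p)\<close> is 1 or -1, each weight is 0 or 2. A
    vanishing sum of nonnegative terms then leaves \<open>a p\<close> nonzero only where the sign of
    \<open>p\<close> is \<open>e\<close>.\<close>
  have "(\<Sum>p\<in>S. (1 - e * of_int (sign p)) * a p) = permanent A - e * det A"
    by (simp add: det_A permanent_def S_def[symmetric] a_def[symmetric]
        left_diff_distrib sum_subtractf sum_distrib_left mult.assoc)
  also have "\<dots> = 0"
    using perm e by simp
  finally have "(\<Sum>p\<in>S. (1 - e * of_int (sign p)) * a p) = 0" .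
  moreover have "0 \<le> (1 - e * of_int (sign p)) * a p" for p
    using e(1) a_nonneg[of p] by (intro mult_nonneg_nonneg) (auto simp: sign_def abs_if split: if_splits)
  ultimately have "(1 - e * of_int (sign p)) * a p = 0" if "p \<in> S" for p
    using that fin by (subst (asm) sum_nonneg_eq_0_iff) auto
  \<comment> \<open>If \<open>a p = 0\<close>, both sides vanish by the shared zero pattern;
    otherwise the weight is 0.\<close>
  then have "b p = e * (of_int (sign p) * b p)" if "p \<in> S" for p
    using that ab[of p] by (cases "a p = 0") auto
  then have "(\<Sum>p\<in>S. b p) = e * det B"
    unfolding det_B sum_distrib_left by (intro sum.cong) auto
  moreover obtain p where "p \<in> S" "a p \<noteq> 0"
    using det unfolding det_A by (metis (no_types, lifting) mult_zero_right sum.neutral)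
  then have "(\<Sum>p\<in>S. b p) \<noteq> 0"
    using ab[of p] b_nonneg fin by (auto simp: sum_nonneg_eq_0_iff)
  ultimately show ?thesis
    by auto
qed

text \<open>Selecting the coordinates \<open>s k\<close> is a linear map that sends the
  \<open>v i\<close> to the rows of a nonsingular matrix; distinctness and independence of the
  images pull back.\<close>

lemma inj_independent_if_minor_nonzero:
  fixes v :: "'m::finite \<Rightarrow> real ^ 'n"
  assumes "det (\<chi> i k. v i $ s k :: real ^ 'm ^ 'm) \<noteq> 0"
  shows "inj v \<and> independent (range v)"
proof -
  define Q where "Q = (\<chi> i k. v i $ s k :: real ^ 'm ^ 'm)"
  define f where "f = (\<lambda>y :: real ^ 'n. (\<chi> k. y $ s k) :: real ^ 'm)"
  have f_v: "f (v i) = row i Q" for i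
    by (simp add: f_def Q_def row_def vec_eq_iff)
  have inj: "inj (\<lambda>i. f (v i))"
    using det_identical_rows[of _ _ Q] assms by (auto simp: inj_def f_v Q_def[symmetric])
  have lin: "linear f"
    by (rule linearI) (simp_all add: f_def vec_eq_iff)
  have "f ` range v = rows Q"
    unfolding rows_def image_image f_v by blast
  then have indep: "independent (f ` range v)"
    using det_dependent_rows[of Q] assms by (auto simp: Q_def[symmetric] dependent_vec_eq)
  have "inj_on f (range v)"
    using inj by (auto simp: inj_def inj_on_def)
  \<comment> \<open>Independence is pulled back by counting: \<open>range v\<close> spans its own
    span with no more elements than the dimension.\<close>
  then have "card (range v) = dim (f ` range v)"
    using indep by (simp add: card_image dim_eq_card_independent)
  also have "\<dots> \<le> dim (range v)"
    by (rule dim_image_le[OF lin])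
  finally have "independent (range v)"
    by (intro card_le_dim_spanning[of "range v" "range v"]) (auto simp: span_superset)
  moreover have "inj v"
    using inj by (auto simp: inj_def)
  ultimately show ?thesis
    by simp
qed

theorem lemma3p16:
  fixes x :: "'n::finite \<Rightarrow> real ^ 'd::finite"
    and \<mu>\<^sub>0 :: "(real ^ 'd) sphere_measure"
    and c :: "'N::finite \<Rightarrow> real"
    and w :: "'N \<Rightarrow> real ^ 'd"
    and \<pi> :: "'N \<Rightarrow> real ^ 'n"
    and P :: "real ^ 'n ^ 'N"
    and s :: "'N \<Rightarrow> 'n"
    and P\<^sub>N :: "real ^ 'N ^ 'N"
  assumes "\<And>j. x j \<noteq> 0"
    and "\<mu>\<^sub>0 = (\<Sum>i\<in>UNIV. c i *\<^sub>R dirac (w i))"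
    and "CARD('N) \<le> CARD('n)"
    and "\<And>i j. \<pi> i $ j \<in> {0, 1}"
    and "\<And>i. w i \<in> dual_region x (\<pi> i) \<inter> sphere 0 1"
    and "P = (\<chi> i j. \<pi> i $ j)"
    and "inj s"
    and "P\<^sub>N = (\<chi> i k. P $ i $ s k)"
    and "rank P\<^sub>N = CARD('N)"
    and "permanent P\<^sub>N = \<bar>det P\<^sub>N\<bar>"
  shows "inj (\<lambda>i. K x (dirac (w i))) \<and> independent (range (\<lambda>i. K x (dirac (w i))))"
proof -
  let ?Q = "(\<chi> i k. K x (dirac (w i)) $ s k) :: real ^ 'N ^ 'N"
  have entry: "?Q $ i $ k = relu (w i \<bullet> x (s k))" and entry_P: "P\<^sub>N $ i $ k = \<pi> i $ s k" for i k
    using assms(5,6,8) by (simp_all add: K_dirac)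
  \<comment> \<open>On a dual region no inner product is zero, so a ReLU value vanishes exactly
    where the 0-1 pattern does.\<close>
  have "\<pi> i $ j = 1 \<and> w i \<bullet> x j > 0 \<or> \<pi> i $ j = 0 \<and> w i \<bullet> x j < 0" for i j
    using assms(4)[of i j] assms(5)[of i] by (auto simp: dual_region_def)
  then have "0 \<le> P\<^sub>N $ i $ k" and "0 \<le> ?Q $ i $ k" and "?Q $ i $ k = 0 \<longleftrightarrow> P\<^sub>N $ i $ k = 0" for i k
    unfolding entry entry_P relu_def by (smt (verit))+
  moreover have "det P\<^sub>N \<noteq> 0"
    using assms(9) by (simp add: det_eq_0_rank)
  ultimately have "det ?Q \<noteq> 0"
    using assms(10) det_nonzero_same_pattern[of P\<^sub>N ?Q] by blast
  then show ?thesis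
    by (rule inj_independent_if_minor_nonzero)
qed

end
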